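(* Let $N$ be a positive integer, let $1<p<N$, and let $p^*=\frac{pN}{N-p}$. Let $\Omega\subseteq\mathbb{R}^N$ be an open connected set with smooth boundary. Let $M:[0,+\infty)\to[0,+\infty)$ be a continuous function and let $\widehat M(t)=\int_0^t M(s)\,\mathrm{d}s$ for $t\ge 0$. Assume that $$\inf_{t>0}\frac{M(t)}{t^{\frac{p^*}{p}-1}}> S_N^{-\frac{p^*}{p}}.$$ Then the functional $\mathcal E:W^{1,p}_0(\Omega)\to\mathbb{R}$ defined by $$\mathcal E(u)=\frac1p\widehat M(\|u\|^p)-\frac{1}{p^*}\|u\|_{p^*}^{p^*}$$ satisfies the Palais--Smale property in $W^{1,p}_0(\Omega)$.
   Context: The space $W^{1,p}_0(\Omega)$ is endowed with the norm $\|u\|=\left(\int_\Omega|\nabla u|^p\,\mathrm{d}x\right)^{1/p}$, and $\|u\|_q=\left(\int_\Omega|u|^q\,\mathrm{d}x\right)^{1/q}$ denotes the norm of $L^q(\Omega)$. $S_N>0$ denotes the (best) embedding constant of $W^{1,p}_0(\Omega)\hookrightarrow L^{p^*}(\Omega)$, i.e. the largest constant such that $\|u\|_{p^*}^p\le S_N^{-1}\|u\|^p$ for every $u\in W^{1,p}_0(\Omega)$. The derivative of $\mathcal E$ at $u$ is $\mathcal E'(u)(v)=M(\|u\|^p)\int_\Omega|\nabla u|^{p-2}\nabla u\cdot\nabla v\,\mathrm{d}x-\int_\Omega|u|^{p^*-2}uv\,\mathrm{d}x$ for $v\in W^{1,p}_0(\Omega)$. The Palais--Smale property means: for every $c\in\mathbb{R}$,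 every sequence $\{u_n\}\subset W^{1,p}_0(\Omega)$ with $\mathcal E(u_n)\to c$ and $\mathcal E'(u_n)\to 0$ in the dual of $W^{1,p}_0(\Omega)$ admits a subsequence converging strongly in $W^{1,p}_0(\Omega)$. *)

theory Defs
  imports "HOL-Analysis.Analysis"
begin

text \<open>Smooth real functions on the whole space, via iterated partial derivatives.\<close>

primrec Ck :: "nat \<Rightarrow> ('a::euclidean_space \<Rightarrow> real) \<Rightarrow> bool" where
  "Ck 0 f \<longleftrightarrow> continuous_on UNIV f"
| "Ck (Suc k) f \<longleftrightarrow> (\<forall>x. f differentiable (at x)) \<and>
      (\<forall>i\<in>Basis. Ck k (\<lambda>x. frechet_derivative f (at x) i))"

definition smooth :: "('a::euclidean_space \<Rightarrow> real) \<Rightarrow> bool" where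
  "smooth f \<longleftrightarrow> (\<forall>k. Ck k f)"

definition grad :: "('a::euclidean_space \<Rightarrow> real) \<Rightarrow> 'a \<Rightarrow> 'a" where
  "grad f x = (\<Sum>i\<in>Basis. frechet_derivative f (at x) i *\<^sub>R i)"

text \<open>Near each boundary point the set is, for a suitable unit vector \<open>e\<close>, the part of the
  ball lying strictly above the graph of a smooth function over the hyperplane orthogonal to \<open>e\<close>.
  That function is given as the restriction of a smooth \<open>\<gamma>\<close> on the whole space, evaluated
  only at the orthogonal projection \<open>y - (y \<bullet> e) *\<^sub>R e\<close>.\<close>

definition smooth_boundary :: "'a::euclidean_space set \<Rightarrow> bool" where
  "smooth_boundary \<Omega> \<longleftrightarrow>
     (\<forall>x\<in>frontier \<Omega>. \<exists>r>0. \<exists>e \<gamma>. norm e = 1 \<and> smooth \<gamma> \<and>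
        \<Omega> \<inter> ball x r = {y \<in> ball x r. \<gamma> (y - (y \<bullet> e) *\<^sub>R e) < y \<bullet> e})"

text \<open>\<open>C\<^sub>c\<^sup>\<infinity>(\<Omega>)\<close>; test functions are extended by zero to the whole space.\<close>

definition test_functions :: "'a::euclidean_space set \<Rightarrow> ('a \<Rightarrow> real) set" where
  "test_functions \<Omega> = {\<phi>. smooth \<phi> \<and> compact (closure {x. \<phi> x \<noteq> 0}) \<and> closure {x. \<phi> x \<noteq> 0} \<subseteq> \<Omega>}"

text \<open>Elements of \<open>L\<^sup>q(\<Omega>)\<close> and of the Sobolev spaces below are represented by functions on the
  whole space whose values outside \<open>\<Omega>\<close> are irrelevant; functions that agree almost everywhere
  on \<open>\<Omega>\<close> are not identified.\<close>

definition Lq_space :: "real \<Rightarrow> 'a::euclidean_space set \<Rightarrow> ('a \<Rightarrow> 'b::euclidean_space) set" where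
  "Lq_space q \<Omega> = {f \<in> borel_measurable (lebesgue_on \<Omega>).
     integrable (lebesgue_on \<Omega>) (\<lambda>x. norm (f x) powr q)}"

definition Lq_norm :: "real \<Rightarrow> 'a::euclidean_space set \<Rightarrow> ('a \<Rightarrow> 'b::euclidean_space) \<Rightarrow> real" where
  "Lq_norm q \<Omega> f = (LINT x|lebesgue_on \<Omega>. norm (f x) powr q) powr (1 / q)"

definition locally_integrable :: "'a::euclidean_space set \<Rightarrow> ('a \<Rightarrow> 'b::euclidean_space) \<Rightarrow> bool" where
  "locally_integrable \<Omega> f \<longleftrightarrow> (\<forall>K. compact K \<and> K \<subseteq> \<Omega> \<longrightarrow> f absolutely_integrable_on K)"

definition has_weak_gradient ::
    "'a::euclidean_space set \<Rightarrow> ('a \<Rightarrow> real) \<Rightarrow> ('a \<Rightarrow> 'a) \<Rightarrow> bool" where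
  "has_weak_gradient \<Omega> u g \<longleftrightarrow> locally_integrable \<Omega> u \<and> locally_integrable \<Omega> g \<and>
     (\<forall>\<phi>\<in>test_functions \<Omega>.
        (LINT x|lebesgue_on \<Omega>. u x *\<^sub>R grad \<phi> x) = - (LINT x|lebesgue_on \<Omega>. \<phi> x *\<^sub>R g x))"

text \<open>The weak gradient is unique up to a null set; \<open>weak_grad\<close> picks a representative.\<close>

definition weak_grad :: "'a::euclidean_space set \<Rightarrow> ('a \<Rightarrow> real) \<Rightarrow> 'a \<Rightarrow> 'a" where
  "weak_grad \<Omega> u = (SOME g. has_weak_gradient \<Omega> u g)"

text \<open>\<open>W\<^sub>0\<^sup>1\<^sup>,\<^sup>p(\<Omega>)\<close> is the closure of \<open>C\<^sub>c\<^sup>\<infinity>(\<Omega>)\<close> in \<open>W\<^sup>1\<^sup>,\<^sup>p(\<Omega>)\<close> for the full Sobolev norm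
  (the \<open>L\<^sup>p\<close> norms of the function and of its gradient), also when \<open>\<Omega>\<close> is unbounded.\<close>

definition W1p0 :: "real \<Rightarrow> 'a::euclidean_space set \<Rightarrow> ('a \<Rightarrow> real) set" where
  "W1p0 p \<Omega> = {u \<in> Lq_space p \<Omega>. \<exists>g\<in>Lq_space p \<Omega>. has_weak_gradient \<Omega> u g \<and>
     (\<exists>\<phi> :: nat \<Rightarrow> 'a \<Rightarrow> real. (\<forall>k. \<phi> k \<in> test_functions \<Omega>) \<and>
        (\<lambda>k. Lq_norm p \<Omega> (\<lambda>x. \<phi> k x - u x)) \<longlonglongrightarrow> 0 \<and>
        (\<lambda>k. Lq_norm p \<Omega> (\<lambda>x. grad (\<phi> k) x - g x)) \<longlonglongrightarrow> 0)}"

definition W1p0_norm :: "real \<Rightarrow> 'a::euclidean_space set \<Rightarrow> ('a \<Rightarrow> real) \<Rightarrow> real" where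
  "W1p0_norm p \<Omega> u = Lq_norm p \<Omega> (weak_grad \<Omega> u)"

definition embedding_bound :: "real \<Rightarrow> real \<Rightarrow> 'a::euclidean_space set \<Rightarrow> real \<Rightarrow> bool" where
  "embedding_bound p q \<Omega> S \<longleftrightarrow> 0 < S \<and> (\<forall>u\<in>W1p0 p \<Omega>. u \<in> Lq_space q \<Omega> \<and>
     Lq_norm q \<Omega> u powr p \<le> inverse S * W1p0_norm p \<Omega> u powr p)"

text \<open>The largest admissible constant; it exists and is unique for nonempty open \<open>\<Omega>\<close> by the
  Sobolev embedding theorem, and does not exist for empty \<open>\<Omega>\<close> (every constant is admissible).\<close>

definition best_embedding_constant :: "real \<Rightarrow> real \<Rightarrow> 'a::euclidean_space set \<Rightarrow> real \<Rightarrow> bool" where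
  "best_embedding_constant p q \<Omega> S \<longleftrightarrow>
     embedding_bound p q \<Omega> S \<and> (\<forall>T. embedding_bound p q \<Omega> T \<longrightarrow> T \<le> S)"

definition primitive :: "(real \<Rightarrow> real) \<Rightarrow> real \<Rightarrow> real" where
  "primitive M t = integral {0..t} M"

definition energy :: "real \<Rightarrow> real \<Rightarrow> 'a::euclidean_space set \<Rightarrow> (real \<Rightarrow> real) \<Rightarrow> ('a \<Rightarrow> real) \<Rightarrow> real" where
  "energy p q \<Omega> M u =
     1 / p * primitive M (W1p0_norm p \<Omega> u powr p) - 1 / q * Lq_norm q \<Omega> u powr q"

definition energy_deriv ::
    "real \<Rightarrow> real \<Rightarrow> 'a::euclidean_space set \<Rightarrow> (real \<Rightarrow> real) \<Rightarrow> ('a \<Rightarrow> real) \<Rightarrow> ('a \<Rightarrow> real) \<Rightarrow> real" where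
  "energy_deriv p q \<Omega> M u v =
     M (W1p0_norm p \<Omega> u powr p) *
       (LINT x|lebesgue_on \<Omega>. norm (weak_grad \<Omega> u x) powr (p - 2) * (weak_grad \<Omega> u x \<bullet> weak_grad \<Omega> v x))
     - (LINT x|lebesgue_on \<Omega>. \<bar>u x\<bar> powr (q - 2) * u x * v x)"

text \<open>Operator norm of a functional on a function space \<open>W\<close> with norm \<open>nrm\<close>, in the form
  \<open>sup |F v| / nrm v\<close> used for \<^const>\<open>onorm\<close>. It is taken in the extended nonnegative reals, so
  it is meaningful without knowing in advance that \<open>F\<close> is bounded.\<close>

definition dual_norm ::
    "('a \<Rightarrow> real) set \<Rightarrow> (('a \<Rightarrow> real) \<Rightarrow> real) \<Rightarrow> (('a \<Rightarrow> real) \<Rightarrow> real) \<Rightarrow> ennreal" where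
  "dual_norm W nrm F = (SUP v\<in>W. ennreal (\<bar>F v\<bar> / nrm v))"

definition palais_smale ::
    "('a \<Rightarrow> real) set \<Rightarrow> (('a \<Rightarrow> real) \<Rightarrow> real) \<Rightarrow> (('a \<Rightarrow> real) \<Rightarrow> real) \<Rightarrow>
     (('a \<Rightarrow> real) \<Rightarrow> ('a \<Rightarrow> real) \<Rightarrow> real) \<Rightarrow> bool" where
  "palais_smale W nrm E E' \<longleftrightarrow>
     (\<forall>(c::real) (u :: nat \<Rightarrow> 'a \<Rightarrow> real).
        (\<forall>k. u k \<in> W) \<and> (\<lambda>k. E (u k)) \<longlonglongrightarrow> c \<and> (\<lambda>k. dual_norm W nrm (E' (u k))) \<longlonglongrightarrow> 0
        \<longrightarrow> (\<exists>(r :: nat \<Rightarrow> nat) w. strict_mono r \<and> w \<in> W \<and>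
               (\<lambda>k. nrm (\<lambda>x. u (r k) x - w x)) \<longlonglongrightarrow> 0))"

end

theory Submission
  imports Defs
begin

text \<open>Testing \<open>E'(u)\<close> with \<open>u\<close> itself, the growth condition on \<open>M\<close> and the Sobolev inequality give
  \<open>E'(u)(u) \<ge> (m - S\<^sub>N\<^sup>-\<^sup>p\<^sup>*\<^sup>/\<^sup>p) \<parallel>u\<parallel>\<^sup>p\<^sup>*\<close>, where \<open>m\<close> is the infimum in the hypothesis.
  Since \<open>p\<^sup>* > 1\<close>, \<open>E'(u\<^sub>n) \<rightarrow> 0\<close> then forces \<open>\<parallel>u\<^sub>n\<parallel> \<rightarrow> 0\<close>: the whole sequence converges to \<open>0\<close>.\<close>

lemma Ck_zero: "Ck k (\<lambda>x::'a::euclidean_space. 0)"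
  by (induction k) auto

lemma grad_zero: "grad (\<lambda>x::'a::euclidean_space. 0) = (\<lambda>x. 0)"
  by (simp add: grad_def fun_eq_iff)

lemma zero_in_test_functions: "(\<lambda>x. 0) \<in> test_functions \<Omega>"
  by (simp add: test_functions_def smooth_def Ck_zero)

lemma has_weak_gradient_zero: "has_weak_gradient \<Omega> (\<lambda>x. 0) (\<lambda>x. 0)"
  by (simp add: has_weak_gradient_def locally_integrable_def)

text \<open>The zero function is the limit found for every Palais-Smale sequence. The constant
  sequence of zero test functions approximates it, with zero as weak gradient.\<close>

lemma zero_in_W1p0: "(\<lambda>x. 0) \<in> W1p0 p \<Omega>"
  unfolding W1p0_def mem_Collect_eq
proof (intro conjI bexI exI allI)
  show "has_weak_gradient \<Omega> (\<lambda>x. 0) (\<lambda>x. 0)"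
    by (rule has_weak_gradient_zero)
  show "(\<lambda>x. 0) \<in> test_functions \<Omega>"
    by (rule zero_in_test_functions)
qed (simp_all add: Lq_space_def Lq_norm_def grad_zero)

lemma Lq_norm_nonneg: "0 \<le> Lq_norm q \<Omega> f"
  by (simp add: Lq_norm_def)

lemma Lq_norm_powr:
  assumes "0 < q"
  shows "Lq_norm q \<Omega> f powr q = (LINT x|lebesgue_on \<Omega>. norm (f x) powr q)"
  using assms by (simp add: Lq_norm_def powr_powr Bochner_Integration.integral_nonneg)

lemma energy_deriv_self:
  assumes "0 < p" "0 < q"
  shows "energy_deriv p q \<Omega> M u u =
    M (W1p0_norm p \<Omega> u powr p) * W1p0_norm p \<Omega> u powr p - Lq_norm q \<Omega> u powr q"
proof -
  \<comment> \<open>For \<open>a = 0\<close> both sides vanish even if \<open>r < 2\<close>, since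
    \<open>0 powr x = 0\<close> for every \<open>x\<close>.\<close>
  have *: "norm a powr (r - 2) * (norm a)\<^sup>2 = norm a powr r" for a :: "'b::real_normed_vector" and r
    by (cases "a = 0") (auto simp: powr_diff)
  have "norm g powr (p - 2) * (g \<bullet> g) = norm g powr p" for g :: 'a
    using *[of g p] by (simp add: power2_norm_eq_inner)
  moreover have "\<bar>y\<bar> powr (q - 2) * y * y = norm y powr q" for y :: real
    using *[of y q] by (simp add: power2_eq_square mult.assoc)
  ultimately show ?thesis
    using assms by (simp add: energy_deriv_def W1p0_norm_def Lq_norm_powr)
qed

text \<open>Both terms of \<open>E'(u)(u)\<close> compare with the same power \<open>q\<close> of
  the norm \<open>n\<close> of \<open>u\<close>: the growth condition at \<open>t = n powr p\<close>
  bounds the first from below, the embedding bounds the second from above.\<close>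

lemma energy_deriv_self_ge:
  assumes "0 < p" "0 < q" and emb: "embedding_bound p q \<Omega> S" and u: "u \<in> W1p0 p \<Omega>"
    and M: "\<And>t. 0 < t \<Longrightarrow> m * t powr (q / p - 1) \<le> M t"
  shows "(m - S powr (- (q / p))) * W1p0_norm p \<Omega> u powr q \<le> energy_deriv p q \<Omega> M u u"
proof -
  define n where "n = W1p0_norm p \<Omega> u"
  have n: "0 \<le> n" by (simp add: n_def W1p0_norm_def Lq_norm_nonneg)
  have S: "0 < S" and le: "Lq_norm q \<Omega> u powr p \<le> inverse S * n powr p"
    using emb u by (auto simp: embedding_bound_def n_def)
  \<comment> \<open>The embedding inequality is raised to the power \<open>q / p\<close>.\<close>
  have "Lq_norm q \<Omega> u powr q = (Lq_norm q \<Omega> u powr p) powr (q / p)"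
    using assms(1) by (simp add: powr_powr)
  also have "\<dots> \<le> (inverse S * n powr p) powr (q / p)"
    using le assms(1,2) by (intro powr_mono2) auto
  also have "\<dots> = S powr (- (q / p)) * n powr q"
    using S assms(1) by (simp add: powr_mult powr_powr powr_minus inverse_powr)
  finally have upper: "Lq_norm q \<Omega> u powr q \<le> S powr (- (q / p)) * n powr q" .
  \<comment> \<open>The growth condition covers only \<open>t > 0\<close>; at \<open>n = 0\<close>
    both sides are zero.\<close>
  have lower: "m * n powr q \<le> M (n powr p) * n powr p"
  proof (cases "n = 0")
    case False
    have "m * n powr q = m * (n powr p) powr (q / p - 1) * n powr p"
      using False n assms(1) by (simp add: powr_powr right_diff_distrib powr_diff)
    also have "\<dots> \<le> M (n powr p) * n powr p"
      using False n by (intro mult_right_mono M) auto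
    finally show ?thesis .
  qed simp
  show ?thesis
    using upper lower unfolding energy_deriv_self[OF assms(1,2)] n_def[symmetric]
    by (simp add: left_diff_distrib)
qed

theorem theorem1p3:
  fixes \<Omega> :: "(real ^ 'n) set" and p pstar S\<^sub>N :: real and M :: "real \<Rightarrow> real"
  assumes "1 < p" and "p < real CARD('n)"
    and "pstar = p * real CARD('n) / (real CARD('n) - p)"
    and "open \<Omega>" and "connected \<Omega>" and "smooth_boundary \<Omega>"
    and "continuous_on {0..} M" and "\<forall>t\<ge>0. 0 \<le> M t"
    and "best_embedding_constant p pstar \<Omega> S\<^sub>N"
    and "(INF t\<in>{0<..}. M t / t powr (pstar / p - 1)) > S\<^sub>N powr (- (pstar / p))"
  shows "palais_smale (W1p0 p \<Omega>) (W1p0_norm p \<Omega>) (energy p pstar \<Omega> M) (energy_deriv p pstar \<Omega> M)"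
proof -
  define m where "m = (INF t\<in>{0<..}. M t / t powr (pstar / p - 1))"
  define \<delta> where "\<delta> = m - S\<^sub>N powr (- (pstar / p))"
  have \<delta>: "0 < \<delta>" using assms(10) by (simp add: \<delta>_def m_def)
  have "p < pstar"
    using assms(1-3) by (simp add: less_divide_eq)
  with assms(1) have q: "1 < pstar" by simp
  \<comment> \<open>A real \<open>INF\<close> is known to be a lower bound only for a family bounded
    below; here 0 serves, as \<open>M\<close> is nonnegative.\<close>
  have bdd: "bdd_below ((\<lambda>t. M t / t powr (pstar / p - 1)) ` {0<..})"
    using assms(8) by (intro bdd_belowI2[of _ 0]) auto
  have M: "m * t powr (pstar / p - 1) \<le> M t" if "0 < t" for t
    using cINF_lower[OF bdd, of t] that by (simp add: m_def le_divide_eq)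
  have emb: "embedding_bound p pstar \<Omega> S\<^sub>N"
    using assms(9) by (simp add: best_embedding_constant_def)
  let ?n = "W1p0_norm p \<Omega>" and ?D = "\<lambda>u. dual_norm (W1p0 p \<Omega>) (W1p0_norm p \<Omega>) (energy_deriv p pstar \<Omega> M u)"
  have n0: "0 \<le> ?n u" for u
    by (simp add: W1p0_norm_def Lq_norm_nonneg)
  \<comment> \<open>The choice \<open>v = u\<close> in the supremum defining the dual norm divides
    the estimate of \<open>E'(u)(u)\<close> by the norm of \<open>u\<close>. If that norm is 0, the
    quotients are 0 by convention and the bound still holds.\<close>
  have bound: "ennreal (\<delta> * ?n u powr (pstar - 1)) \<le> ?D u" if u: "u \<in> W1p0 p \<Omega>" for u
  proof -
    have "\<delta> * ?n u powr pstar \<le> \<bar>energy_deriv p pstar \<Omega> M u u\<bar>"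
      using energy_deriv_self_ge[OF _ _ emb u M] assms(1) q by (simp add: \<delta>_def)
    then have "\<delta> * ?n u powr pstar / ?n u \<le> \<bar>energy_deriv p pstar \<Omega> M u u\<bar> / ?n u"
      using n0 by (rule divide_right_mono)
    moreover have "\<delta> * ?n u powr (pstar - 1) = \<delta> * ?n u powr pstar / ?n u"
      using n0[of u] by (cases "?n u = 0") (auto simp: powr_diff)
    ultimately show ?thesis
      unfolding dual_norm_def using u by (intro SUP_upper2[of u] ennreal_leI) auto
  qed
  show ?thesis
    unfolding palais_smale_def
  proof (intro allI impI, elim conjE)
    fix u :: "nat \<Rightarrow> real ^ 'n \<Rightarrow> real"
    assume u: "\<forall>k. u k \<in> W1p0 p \<Omega>" and D: "(\<lambda>k. ?D (u k)) \<longlonglongrightarrow> 0"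
    \<comment> \<open>The squeeze takes place in \<open>ennreal\<close>, where the dual norm lives;
      nonnegativity then brings the limit back to the reals.\<close>
    have "(\<lambda>k. ennreal (\<delta> * ?n (u k) powr (pstar - 1))) \<longlonglongrightarrow> ennreal 0"
      using bound u by (intro tendsto_sandwich[OF _ _ tendsto_const D[folded ennreal_0]]) auto
    then have "(\<lambda>k. \<delta> * ?n (u k) powr (pstar - 1)) \<longlonglongrightarrow> 0"
      using \<delta> by (subst (asm) tendsto_ennreal_iff) auto
    then have "(\<lambda>k. inverse \<delta> * (\<delta> * ?n (u k) powr (pstar - 1))) \<longlonglongrightarrow> 0"
      by (rule tendsto_mult_right_zero)
    then have "(\<lambda>k. ?n (u k) powr (pstar - 1)) \<longlonglongrightarrow> 0"
      using \<delta> by (simp add: mult.assoc[symmetric])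
    \<comment> \<open>Because \<open>pstar > 1\<close>, the inverse exponent is positive, so taking
      the root preserves convergence to 0.\<close>
    then have "(\<lambda>k. (?n (u k) powr (pstar - 1)) powr (1 / (pstar - 1))) \<longlonglongrightarrow> 0"
      by (rule tendsto_zero_powrI[OF _ tendsto_const]) (use q in auto)
    then have "(\<lambda>k. ?n (u k)) \<longlonglongrightarrow> 0"
      using q n0 by (simp add: powr_powr)
    then show "\<exists>r w. strict_mono r \<and> w \<in> W1p0 p \<Omega> \<and> (\<lambda>k. ?n (\<lambda>x. u (r k) x - w x)) \<longlonglongrightarrow> 0"
      using zero_in_W1p0
      by (intro exI[of _ "\<lambda>k. k"] exI[of _ "\<lambda>x. 0"]) (simp add: strict_mono_def)
  qed
qed

end
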